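(* Let $n \in \mathbb{Z}_{\geq 2}$ have prime factorization $n = \prod_{j=1}^m p_j^{k_j}$ ($p_j$ distinct primes, $k_j \geq 1$) and let $K_n = \max_{1\le j\le m} k_j$. As the coefficient $c$ varies from $1$ to $n-1$, the infinite binary orbits $\mathcal{B}(\{T_{n,c}^t x_o\}_{t \geq K_n})$ fall into exactly $2^m-1$ distinct types; that is, the set $$\left\{ \mathcal{B}(\{T_{n,c}^t x_o\}_{t \geq K_n}) \;:\; 1 \leq c \leq n-1,\ \text{the orbit } \{T_{n,c}^t x_o\}_{t\ge 0} \text{ grows infinitely} \right\}$$ has exactly $2^m-1$ elements.
   Context: Fix $D, J \in \mathbb{Z}_{\geq 1}$ and vectors $\boldsymbol{r}_1,\dots,\boldsymbol{r}_J \in \mathbb{Z}^D$ (the same for all automata considered). For $n \in \mathbb{Z}_{\ge 2}$ and nonzero $c \in \mathbb{Z}/n\mathbb{Z}$, the linear cellular automaton with uniform weights (LCA-UW) $T_{n,c} : (\mathbb{Z}/n\mathbb{Z})^{\mathbb{Z}^D} \to (\mathbb{Z}/n\mathbb{Z})^{\mathbb{Z}^D}$ is defined by $(T_{n,c}x)_{\boldsymbol{i}} = \sum_{j=1}^J c\, x_{\boldsymbol{i}+\boldsymbol{r}_j} \pmod n$ for $\boldsymbol{i}\in\mathbb{Z}^D$; $T_{n,c}^t$ is its $t$-th iterate. The single-site seed $x_o$ is the configuration with value $1$ at $\boldsymbol{0}$ and $0$ elsewhere. The orbit $\{T_{n,c}^t x_o\}_{t\ge 0}$ grows infinitely if for every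 $t \in \mathbb{Z}_{\ge 0}$ there is $\boldsymbol{i} \in \mathbb{Z}^D$ with $(T_{n,c}^t x_o)_{\boldsymbol{i}} \neq 0$. The binary projection operator $\mathcal{B}$ sends a space-time configuration with values in $\mathbb{Z}/n\mathbb{Z}$ to the $\{0,1\}$-valued space-time configuration that is $1$ at $(\boldsymbol{i},t)$ if the value there is nonzero and $0$ if the value there is zero; its image of an orbit is called a binary orbit, and an infinite binary orbit is the binary orbit of an orbit that grows infinitely. $\mathcal{B}(\{T_{n,c}^t x_o\}_{t\ge K})$ denotes the restriction of the binary orbit to times $t \geq K$ and all sites $\boldsymbol{i} \in \mathbb{Z}^D$; two such objects are equal iff they agree at all $(\boldsymbol{i},t)$ with $\boldsymbol{i}\in\mathbb{Z}^D$, $t \geq K$.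
   Formalization: The vectors r_1,...,r_J are assumed pairwise distinct, and when J = 1 it is assumed that m = 1; without these the claim fails (J=2, r_1=r_2, n=2 gives no infinite orbit; J=1, n=6 gives one type instead of three). *)

theory Defs
  imports "HOL-Analysis.Finite_Cartesian_Product"
    "HOL-Computational_Algebra.Primes"
    "HOL-Library.FuncSet"
begin

text \<open>
  Sites are elements of \<^typ>\<open>int ^ 'd\<close> with \<open>D = CARD('d)\<close>. Residues modulo \<open>n\<close> are
  represented by their canonical representatives \<open>0, \<dots>, n - 1\<close> in \<^typ>\<open>nat\<close>; hence a residue
  is zero iff its representative is \<open>0\<close>.
\<close>

type_synonym 'd config = "int ^ 'd \<Rightarrow> nat"

type_synonym 'd spacetime = "(int ^ 'd) \<times> nat \<Rightarrow> nat"

definition lca_uw ::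
  "nat \<Rightarrow> (nat \<Rightarrow> int ^ 'd::finite) \<Rightarrow> nat \<Rightarrow> nat \<Rightarrow> 'd config \<Rightarrow> 'd config" where
  "lca_uw J r n c x = (\<lambda>i. (\<Sum>j = 1..J. c * x (i + r j)) mod n)"

text \<open>The seed takes values in the canonical representatives only for \<open>n \<ge> 2\<close>.\<close>

definition single_site_seed :: "'d::finite config" where
  "single_site_seed = (\<lambda>i. if i = 0 then 1 else 0)"

definition lca_orbit ::
  "nat \<Rightarrow> (nat \<Rightarrow> int ^ 'd::finite) \<Rightarrow> nat \<Rightarrow> nat \<Rightarrow> 'd spacetime" where
  "lca_orbit J r n c = (\<lambda>(i, t). (lca_uw J r n c ^^ t) single_site_seed i)"

definition grows_infinitely :: "'d::finite spacetime \<Rightarrow> bool" where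
  "grows_infinitely u \<longleftrightarrow> (\<forall>t. \<exists>i. u (i, t) \<noteq> 0)"

definition binary_projection :: "'d::finite spacetime \<Rightarrow> 'd spacetime" where
  "binary_projection u = (\<lambda>s. if u s \<noteq> 0 then 1 else 0)"

text \<open>
  Outside the times \<open>t \<ge> K\<close> the value of \<^const>\<open>restrict\<close> is \<^const>\<open>undefined\<close>, so two
  restrictions are equal iff they agree at all \<open>(i, t)\<close> with \<open>t \<ge> K\<close>.
\<close>

definition from_time :: "nat \<Rightarrow> 'd::finite spacetime \<Rightarrow> 'd spacetime" where
  "from_time K u = restrict u (UNIV \<times> {K..})"

end

theory Submission
  imports Defs "HOL-Computational_Algebra.Polynomial"
begin

text \<open>
  The orbit at \<open>(i, t)\<close> is \<open>c\<^sup>t a\<^sub>t(i)\<close> modulo \<open>n\<close>, where \<open>a\<^sub>t(i)\<close> counts the paths of length \<open>t\<close>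
  from \<open>i\<close> to \<open>0\<close>. From time \<open>K\<^sub>n\<close> on, the primes dividing \<open>c\<close> impose no condition any more, so the
  binary orbit depends only on the set \<open>S\<close> of the primes that do not divide \<open>c\<close>; the orbit grows
  infinitely iff \<open>S\<close> is nonempty. To tell two such sets apart, choose an additive functional that
  is injective on the \<open>r j\<close>, and let \<open>u\<close> and \<open>v\<close> be the indices of its largest and second largest
  values. Then \<open>a\<^sub>t(- t r\<^sub>u) = 1\<close> and \<open>a\<^sub>t(- (t - 1) r\<^sub>u - r\<^sub>v) = t\<close>, so every \<open>t\<close> is itself
  a path count at time \<open>t\<close>, and the divisors of \<open>t\<close> can be prescribed.
\<close>

section \<open>Separating finitely many vectors by an additive functional\<close>

text \<open>Vectors become integer polynomials, evaluated at a point \<open>b\<close>. Two distinct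
  vectors collide only if \<open>b\<close> is a root of their nonzero difference, and finitely many
  differences have finitely many roots.\<close>

lemma ex_additive_inj_on:
  fixes A :: "(int ^ 'd::finite) set"
  assumes "finite A"
  obtains f :: "int ^ 'd \<Rightarrow> int"
  where "inj_on f A" and "\<And>x y. f (x + y) = f x + f y" and "\<And>x y. f (x - y) = f x - f y"
proof -
  obtain e :: "'d \<Rightarrow> nat" where "bij_betw e UNIV {0..<CARD('d)}"
    using ex_bij_betw_finite_nat[of "UNIV :: 'd set"] by auto
  then have e: "inj e"
    by (simp add: bij_betw_def)
  define P :: "int ^ 'd \<Rightarrow> int poly" where "P x = (\<Sum>i\<in>UNIV. monom (x $ i) (e i))" for x
  have coeff_P: "coeff (P x) (e i) = x $ i" for x i
    using e by (simp add: P_def coeff_sum inj_eq)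
  have P_nz: "P x \<noteq> 0" if "x \<noteq> 0" for x
  proof
    assume "P x = 0"
    then have "x $ i = 0" for i
      using coeff_P[of x i] by simp
    with that show False
      by (simp add: vec_eq_iff)
  qed
  define D where "D = {x - y | x y. x \<in> A \<and> y \<in> A \<and> x \<noteq> y}"
  have "D \<subseteq> (\<lambda>(x, y). x - y) ` (A \<times> A)"
    by (auto simp: D_def)
  then have "finite D"
    using assms by (meson finite_SigmaI finite_imageI finite_subset)
  then have "finite (\<Union>d\<in>D. {b. poly (P d) b = 0})"
    by (intro finite_UN_I poly_roots_finite P_nz) (auto simp: D_def)
  then obtain b where b: "b \<notin> (\<Union>d\<in>D. {b. poly (P d) b = 0})"
    using ex_new_if_finite[OF infinite_UNIV_int] by blast
  define f where "f x = poly (P x) b" for x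
  have add: "f (x + y) = f x + f y" for x y
    by (simp add: f_def P_def poly_sum poly_monom sum.distrib algebra_simps)
  have diff: "f (x - y) = f x - f y" for x y
    using add[of "x - y" y] by simp
  have "inj_on f A"
  proof (rule inj_onI, rule ccontr)
    fix x y assume "x \<in> A" "y \<in> A" "f x = f y" "x \<noteq> y"
    then have "x - y \<in> D" "f (x - y) = 0"
      by (auto simp: D_def diff)
    with b show False
      by (auto simp: f_def)
  qed
  with add diff show thesis
    using that by blast
qed

section \<open>Path counts\<close>

text \<open>This is the coefficient of \<open>x^(-i)\<close> in the \<open>t\<close>-th power of the
  Laurent polynomial with terms \<open>x^(r j)\<close>. It is not reduced, so one count serves all
  \<open>n\<close> and \<open>c\<close>.\<close>

fun path_count :: "nat \<Rightarrow> (nat \<Rightarrow> int ^ 'd::finite) \<Rightarrow> nat \<Rightarrow> int ^ 'd \<Rightarrow> nat" where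
  "path_count J r 0 i = (if i = 0 then 1 else 0)"
| "path_count J r (Suc t) i = (\<Sum>j = 1..J. path_count J r t (i + r j))"

lemma lca_orbit_eq_path_count:
  assumes "n \<ge> 2"
  shows "lca_orbit J r n c (i, t) = c ^ t * path_count J r t i mod n"
proof (induction t arbitrary: i)
  case 0
  then show ?case
    using assms by (simp add: lca_orbit_def single_site_seed_def)
next
  case (Suc t)
  have "lca_orbit J r n c (i, Suc t) = (\<Sum>j = 1..J. c * lca_orbit J r n c (i + r j, t)) mod n"
    by (simp add: lca_orbit_def lca_uw_def)
  also have "\<dots> = (\<Sum>j = 1..J. c * (c ^ t * path_count J r t (i + r j) mod n) mod n) mod n"
    by (simp add: Suc mod_sum_eq)
  also have "\<dots> = (\<Sum>j = 1..J. c * (c ^ t * path_count J r t (i + r j))) mod n"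
    by (simp add: mod_mult_right_eq mod_sum_eq)
  finally show ?case
    by (simp add: sum_distrib_left mult.assoc)
qed

text \<open>Each step raises \<open>f\<close> by at most \<open>M\<close>, and a path must end at
  \<open>0\<close>, where \<open>f\<close> vanishes. From such a site \<open>t\<close> steps cannot
  climb that far.\<close>

lemma path_count_beyond_extreme:
  fixes f :: "int ^ 'd::finite \<Rightarrow> int"
  assumes add: "\<And>x y. f (x + y) = f x + f y"
    and M: "\<And>j. j \<in> {1..J} \<Longrightarrow> f (r j) \<le> M"
    and "f i < - int t * M"
  shows "path_count J r t i = 0"
  using assms(3)
proof (induction t arbitrary: i)
  case 0
  have "f 0 = 0"
    using add[of 0 0] by simp
  with 0 show ?case
    by auto
next
  case (Suc t)
  have "path_count J r t (i + r j) = 0" if "j \<in> {1..J}" for j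
    using Suc.prems M[OF that] by (intro Suc.IH) (simp add: add algebra_simps)
  then show ?case
    by simp
qed

lemma vector_sub_1_left: "(x :: int ^ 'd::finite) - int (Suc t) *s y + y = x - int t *s y"
  by (simp add: vec_eq_iff algebra_simps)

lemma additive_diff_smult:
  fixes f :: "int ^ 'd::finite \<Rightarrow> int"
  assumes add: "\<And>x y. f (x + y) = f x + f y"
  shows "f (x - int t *s y) = f x - int t * f y"
proof (induction t)
  case 0
  show ?case by simp
next
  case (Suc t)
  then show ?case
    using add[of "x - int (Suc t) *s y" y] unfolding vector_sub_1_left by (simp add: algebra_simps)
qed

text \<open>Only the path that always steps by \<open>r u\<close> arrives: any other first step
  loses height that the remaining steps cannot regain.\<close>

lemma path_count_extreme:
  fixes f :: "int ^ 'd::finite \<Rightarrow> int"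
  assumes add: "\<And>x y. f (x + y) = f x + f y"
    and u: "u \<in> {1..J}" "\<And>j. j \<in> {1..J} - {u} \<Longrightarrow> f (r j) < f (r u)"
  shows "path_count J r t (0 - int t *s r u) = 1"
proof (induction t)
  case 0
  then show ?case by simp
next
  case (Suc t)
  have f0: "f 0 = 0"
    using add[of 0 0] by simp
  have "path_count J r t (0 - int (Suc t) *s r u + r j) = 0" if "j \<in> {1..J} - {u}" for j
  proof (rule path_count_beyond_extreme[of f, OF add])
    show "f (r j) \<le> f (r u)" if "j \<in> {1..J}" for j
      using u(2)[of j] that by (cases "j = u") auto
    show "f (0 - int (Suc t) *s r u + r j) < - int t * f (r u)"
      unfolding add additive_diff_smult[of f, OF add] f0
      using u(2)[OF that] by (simp add: algebra_simps)
  qed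
  then have "path_count J r (Suc t) (0 - int (Suc t) *s r u)
      = path_count J r t (0 - int (Suc t) *s r u + r u)"
    using sum.remove[OF finite_atLeastAtMost u(1), of "\<lambda>j. path_count J r t (0 - int (Suc t) *s r u + r j)"]
    by (simp del: of_nat_Suc)
  with Suc show ?case
    unfolding vector_sub_1_left by simp
qed

text \<open>A path from this site steps by \<open>r v\<close> exactly once and by \<open>r u\<close>
  otherwise, so the position of the \<open>r v\<close> step is the only choice. Writing the site
  with \<open>r u - r v\<close> avoids \<open>t - 1\<close> and covers \<open>t = 0\<close>.\<close>

lemma path_count_next_to_extreme:
  fixes f :: "int ^ 'd::finite \<Rightarrow> int"
  assumes add: "\<And>x y. f (x + y) = f x + f y"
    and u: "u \<in> {1..J}" "\<And>j. j \<in> {1..J} - {u} \<Longrightarrow> f (r j) < f (r u)"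
    and v: "v \<in> {1..J} - {u}" "\<And>j. j \<in> {1..J} - {u, v} \<Longrightarrow> f (r j) < f (r v)"
  shows "path_count J r t (r u - r v - int t *s r u) = t"
proof (induction t)
  case 0
  have "r u \<noteq> r v"
    using u(2)[OF v(1)] by auto
  then show ?case by simp
next
  case (Suc t)
  let ?i = "r u - r v - int (Suc t) *s r u"
  have f_diff: "f (x - y) = f x - f y" for x y
    using add[of "x - y" y] by simp
  have "path_count J r t (?i + r j) = 0" if "j \<in> {1..J} - {u} - {v}" for j
  proof (rule path_count_beyond_extreme[of f, OF add])
    show "f (r j) \<le> f (r u)" if "j \<in> {1..J}" for j
      using u(2)[of j] that by (cases "j = u") auto
    \<comment> \<open>After a first step by \<open>r j\<close>, the value of \<open>f\<close> is
      below \<open>- int t * f (r u)\<close> by the gap \<open>f (r v) - f (r j)\<close>.\<close>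
    have "f (r j) < f (r v)"
      using that by (intro v(2)) auto
    then show "f (?i + r j) < - int t * f (r u)"
      unfolding add additive_diff_smult[of f, OF add] unfolding f_diff
      by (simp add: algebra_simps)
  qed
  then have "path_count J r (Suc t) ?i
      = path_count J r t (?i + r u) + path_count J r t (?i + r v)"
    using sum.remove[OF finite_atLeastAtMost u(1), of "\<lambda>j. path_count J r t (?i + r j)"]
      sum.remove[OF _ v(1), of "\<lambda>j. path_count J r t (?i + r j)"]
    by (simp del: of_nat_Suc)
  moreover have "?i + r v = 0 - int t *s r u"
    by (simp add: vec_eq_iff algebra_simps)
  ultimately show ?case
    using Suc path_count_extreme[of f u J r t, OF add u]
    unfolding vector_sub_1_left by simp
qed

lemma ex_max_on_finite:
  fixes g :: "'a \<Rightarrow> int"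
  assumes "finite A" "A \<noteq> {}" "inj_on g A"
  obtains u where "u \<in> A" and "\<And>j. j \<in> A - {u} \<Longrightarrow> g j < g u"
proof -
  have "Max (g ` A) \<in> g ` A"
    using assms by (intro Max_in) auto
  then obtain u where u: "u \<in> A" "g u = Max (g ` A)"
    by auto
  have "g j < g u" if "j \<in> A - {u}" for j
  proof -
    have "g j \<le> g u"
      using that u assms(1) by simp
    moreover have "g j \<noteq> g u"
      using that u(1) assms(3) by (auto dest: inj_onD)
    ultimately show ?thesis
      by simp
  qed
  with u(1) show thesis
    using that by blast
qed

text \<open>At a site with count 1 the orbit has the value \<open>c ^ t mod n\<close>, which decides
  growth.\<close>

lemma ex_path_count_eq_1:
  fixes r :: "nat \<Rightarrow> int ^ 'd::finite"
  assumes "J \<ge> 1" and "inj_on r {1..J}"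
  shows "\<exists>i. path_count J r t i = 1"
proof -
  obtain f :: "int ^ 'd \<Rightarrow> int" where inj: "inj_on f (r ` {1..J})"
    and add: "\<And>x y. f (x + y) = f x + f y"
    by (rule ex_additive_inj_on[of "r ` {1..J}"]) auto
  obtain u where "u \<in> {1..J}" "\<And>j. j \<in> {1..J} - {u} \<Longrightarrow> (f \<circ> r) j < (f \<circ> r) u"
    using ex_max_on_finite[of "{1..J}" "f \<circ> r"] assms inj by (auto simp: comp_inj_on)
  then have "path_count J r t (0 - int t *s r u) = 1"
    by (intro path_count_extreme[of f, OF add]) auto
  then show ?thesis ..
qed

lemma ex_path_count_eq_time:
  fixes r :: "nat \<Rightarrow> int ^ 'd::finite"
  assumes "J \<ge> 2" and "inj_on r {1..J}"
  shows "\<exists>i. path_count J r t i = t"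
proof -
  obtain f :: "int ^ 'd \<Rightarrow> int" where "inj_on f (r ` {1..J})"
    and add: "\<And>x y. f (x + y) = f x + f y"
    by (rule ex_additive_inj_on[of "r ` {1..J}"]) auto
  then have inj: "inj_on (f \<circ> r) {1..J}"
    using assms(2) by (intro comp_inj_on)
  obtain u where u: "u \<in> {1..J}" "\<And>j. j \<in> {1..J} - {u} \<Longrightarrow> (f \<circ> r) j < (f \<circ> r) u"
    using ex_max_on_finite[of "{1..J}" "f \<circ> r"] assms inj by auto
  have "(if u = 1 then 2 else 1) \<in> {1..J} - {u}"
    using assms(1) by auto
  then have "{1..J} - {u} \<noteq> {}"
    by blast
  then obtain v where v: "v \<in> {1..J} - {u}"
      "\<And>j. j \<in> {1..J} - {u} - {v} \<Longrightarrow> (f \<circ> r) j < (f \<circ> r) v"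
    using ex_max_on_finite[of "{1..J} - {u}" "f \<circ> r"] inj_on_subset[OF inj, of "{1..J} - {u}"] by auto
  have "path_count J r t (r u - r v - int t *s r u) = t"
    using u v by (intro path_count_next_to_extreme[of f, OF add]) auto
  then show ?thesis ..
qed

section \<open>Classification of the binary orbits by sets of primes\<close>

lemma prod_dvd_iff_of_pairwise_coprime:
  fixes q :: "'a \<Rightarrow> nat"
  assumes "finite A" and "\<And>i j. i \<in> A \<Longrightarrow> j \<in> A \<Longrightarrow> i \<noteq> j \<Longrightarrow> coprime (q i) (q j)"
  shows "prod q A dvd x \<longleftrightarrow> (\<forall>j\<in>A. q j dvd x)"
  using assms
proof (induction A rule: finite_induct)
  case empty
  then show ?case by simp
next
  case (insert a A)
  have "coprime (q a) (prod q A)"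
    using insert.hyps insert.prems by (intro prod_coprime_right) auto
  then have "q a * prod q A dvd x \<longleftrightarrow> q a dvd x \<and> prod q A dvd x"
    by (meson divides_mult dvd_mult_left dvd_mult_right)
  with insert show ?case
    by simp
qed

text \<open>The last hypothesis is there because for \<open>J = 1\<close> all path counts are 0 or
  1. All nonempty sets of primes then give the same binary orbit, and the single type matches
  \<open>2 ^ m - 1\<close> only for \<open>m = 1\<close>.\<close>

theorem proposition1:
  fixes J n m :: nat
    and r :: "nat \<Rightarrow> int ^ 'd::finite"
    and p k :: "nat \<Rightarrow> nat"
  assumes "J \<ge> 1"
    and "inj_on r {1..J}"
    and "n \<ge> 2"
    and "\<And>j. j \<in> {1..m} \<Longrightarrow> prime (p j)"
    and "inj_on p {1..m}"
    and "\<And>j. j \<in> {1..m} \<Longrightarrow> k j \<ge> 1"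
    and "n = (\<Prod>j = 1..m. p j ^ k j)"
    and "J = 1 \<Longrightarrow> m = 1"
  shows "card {from_time (Max (k ` {1..m})) (binary_projection (lca_orbit J r n c)) | c.
                 1 \<le> c \<and> c \<le> n - 1 \<and> grows_infinitely (lca_orbit J r n c)}
         = 2 ^ m - 1"
proof -
  define q where "q j = p j ^ k j" for j
  define K where "K = Max (k ` {1..m})"
  define supp where "supp c = {j \<in> {1..m}. \<not> p j dvd c}" for c
  define B :: "nat set \<Rightarrow> 'd spacetime" where
    "B S = from_time K (\<lambda>(i, t). if \<exists>j\<in>S. \<not> q j dvd path_count J r t i then 1 else 0)" for S
  have k_le_K: "k j \<le> K" if "j \<in> {1..m}" for j
    using that by (simp add: K_def)
  have p_coprime: "coprime (p i) (p j)" if "i \<in> {1..m}" "j \<in> {1..m}" "i \<noteq> j" for i j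
    using that assms(4,5) by (intro primes_coprime) (auto dest: inj_onD)
  have q_coprime: "coprime (q i) (q j)" if "i \<in> {1..m}" "j \<in> {1..m}" "i \<noteq> j" for i j
    using p_coprime[OF that] by (simp add: q_def)
  have p_coprime_q: "coprime (p i) (q j)" if "i \<in> {1..m}" "j \<in> {1..m}" "i \<noteq> j" for i j
    using p_coprime[OF that] by (simp add: q_def)
  have n_dvd_iff: "n dvd x \<longleftrightarrow> (\<forall>j\<in>{1..m}. q j dvd x)" for x
    unfolding assms(7) q_def[symmetric]
    by (rule prod_dvd_iff_of_pairwise_coprime) (auto intro: q_coprime)
  have q_gt_1: "q j > 1" if "j \<in> {1..m}" for j
    using assms(4,6)[OF that] unfolding q_def by (intro one_less_power) (auto dest: prime_gt_1_nat)
  have q_gt_0: "q j > 0" if "j \<in> {1..m}" for j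
    using q_gt_1[OF that] by simp
  have p_dvd_q: "p j dvd q j" if "j \<in> {1..m}" for j
    using assms(6)[OF that] by (simp add: q_def)

  \<comment> \<open>Argue for each prime power separately: \<open>c ^ t\<close> is a unit modulo
    \<open>q j\<close> if \<open>p j\<close> does not divide \<open>c\<close>, and is divisible by
    \<open>q j\<close> otherwise, because \<open>t\<close> is at least \<open>K\<close> and hence at
    least \<open>k j\<close>.\<close>
  have orbit_nonzero_iff: "lca_orbit J r n c (i, t) \<noteq> 0
      \<longleftrightarrow> (\<exists>j\<in>supp c. \<not> q j dvd path_count J r t i)" if "t \<ge> K" for c i t
  proof -
    have "q j dvd c ^ t * path_count J r t i \<longleftrightarrow> j \<in> supp c \<longrightarrow> q j dvd path_count J r t i"
      if j: "j \<in> {1..m}" for j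
    proof (cases "j \<in> supp c")
      case True
      then have "coprime (p j) c"
        using assms(4) by (auto simp: supp_def intro: prime_imp_coprime)
      then have "coprime (q j) (c ^ t)"
        by (simp add: q_def)
      with True show ?thesis
        by (simp add: coprime_dvd_mult_right_iff)
    next
      case False
      then have "p j dvd c"
        using j by (simp add: supp_def)
      then have "q j dvd c ^ t"
        using k_le_K[OF j] \<open>t \<ge> K\<close> unfolding q_def by (intro dvd_power_le) auto
      with False show ?thesis
        by simp
    qed
    then have "n dvd c ^ t * path_count J r t i
        \<longleftrightarrow> (\<forall>j\<in>supp c. q j dvd path_count J r t i)"
      unfolding n_dvd_iff by (auto simp: supp_def)
    then show ?thesis
      by (simp add: lca_orbit_eq_path_count[OF assms(3)] mod_eq_0_iff_dvd)
  qed
  have type_eq: "from_time K (binary_projection (lca_orbit J r n c)) = B (supp c)" for c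
    unfolding B_def from_time_def binary_projection_def
    by (rule restrict_ext) (use orbit_nonzero_iff in force)

  have grows_iff: "grows_infinitely (lca_orbit J r n c) \<longleftrightarrow> supp c \<noteq> {}" for c
  proof
    assume "grows_infinitely (lca_orbit J r n c)"
    then show "supp c \<noteq> {}"
      \<comment> \<open>A nonzero value at the single time \<open>K\<close> suffices here.\<close>
      using orbit_nonzero_iff[of K c] by (auto simp: grows_infinitely_def)
  next
    assume "supp c \<noteq> {}"
    then obtain j where j: "j \<in> {1..m}" "\<not> p j dvd c"
      by (auto simp: supp_def)
    show "grows_infinitely (lca_orbit J r n c)"
      unfolding grows_infinitely_def
    proof
      fix t
      obtain i where i: "path_count J r t i = 1"
        using ex_path_count_eq_1[OF assms(1,2)] by blast
      have "\<not> p j dvd c ^ t"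
        using assms(4)[OF j(1)] j(2) prime_dvd_power by blast
      moreover have "p j dvd n"
        using n_dvd_iff[of n] j(1) by (intro dvd_trans[OF p_dvd_q]) auto
      ultimately have "\<not> n dvd c ^ t"
        by (meson dvd_trans)
      then show "\<exists>i. lca_orbit J r n c (i, t) \<noteq> 0"
        using i by (intro exI[of _ i])
          (simp add: lca_orbit_eq_path_count[OF assms(3)] mod_eq_0_iff_dvd)
    qed
  qed

  have ex_supp: "\<exists>c. 1 \<le> c \<and> c \<le> n - 1 \<and> supp c = S" if S: "S \<subseteq> {1..m}" "S \<noteq> {}" for S
  proof -
    \<comment> \<open>The prime powers outside \<open>S\<close> make up \<open>c\<close>, so that
      exactly the primes outside \<open>S\<close> divide it; the full set gives
      \<open>c = 1\<close>.\<close>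
    define c where "c = prod q ({1..m} - S)"
    have "c \<ge> 1"
      unfolding c_def using q_gt_1 by (intro prod_ge_1) (auto intro: less_imp_le)
    obtain l where l: "l \<in> S" "l \<in> {1..m}"
      using S by blast
    have "n = prod q S * c"
      unfolding c_def assms(7) q_def[symmetric]
      using prod.subset_diff[OF S(1), of q] by (simp add: mult.commute)
    \<comment> \<open>Here \<open>S\<close> must be nonempty: the cofactor of \<open>c\<close> in
      \<open>n\<close> is then at least 2, which keeps \<open>c\<close> within
      \<open>n - 1\<close>.\<close>
    moreover have "prod q S \<ge> 2"
    proof -
      have "q l dvd prod q S"
        using l S(1) by (intro dvd_prodI) (auto intro: finite_subset)
      moreover have "prod q S > 0"
        using S(1) q_gt_0 by (intro prod_pos) blast
      ultimately have "q l \<le> prod q S"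
        by (rule dvd_imp_le)
      with q_gt_1[OF l(2)] show ?thesis
        by simp
    qed
    ultimately have "n \<ge> 2 * c"
      by simp
    have dvd_c: "p j dvd c \<longleftrightarrow> j \<notin> S" if j: "j \<in> {1..m}" for j
    proof
      assume "j \<notin> S"
      then have "q j dvd c"
        using j unfolding c_def by (intro dvd_prodI) auto
      then show "p j dvd c"
        by (rule dvd_trans[OF p_dvd_q[OF j]])
    next
      assume "p j dvd c"
      then show "j \<notin> S"
      proof (rule contrapos_pn)
        assume "j \<in> S"
        then have "coprime (p j) c"
          unfolding c_def by (intro prod_coprime_right p_coprime_q[OF j]) blast+
        then show "\<not> p j dvd c"
          using assms(4)[OF j] by (metis coprime_absorb_left not_prime_unit)
      qed
    qed
    have "supp c = S"
      using S(1) dvd_c by (auto simp: supp_def)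
    with \<open>c \<ge> 1\<close> \<open>n \<ge> 2 * c\<close> show ?thesis
      by (intro exI[of _ c]) auto
  qed

  have mem_if_B_eq: "j \<in> S'"
    if S: "S \<subseteq> {1..m}" "S' \<subseteq> {1..m}" "S' \<noteq> {}" and eq: "B S = B S'" and j: "j \<in> S" for S S' j
  proof (rule ccontr)
    assume "j \<notin> S'"
    \<comment> \<open>For \<open>m = 1\<close> there is only one nonempty set, so the two sets could
      not differ. Excluding this case yields \<open>J \<ge> 2\<close>, needed for a second largest
      step.\<close>
    have "m \<noteq> 1"
    proof
      assume "m = 1"
      with S j have "j = 1" "S' = {1}"
        by auto
      with \<open>j \<notin> S'\<close> show False
        by simp
    qed
    with assms(1,8) have "J \<ge> 2"
      by (cases "J = 1") auto
    text \<open>This time is at least \<open>K\<close>, divisible by \<open>q l\<close> for every \<open>l \<in> S'\<close>, and prime to \<open>p j\<close>.\<close>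
    define t where "t = prod q S' * (p j * K + 1)"
    obtain i where i: "path_count J r t i = t"
      using ex_path_count_eq_time[OF \<open>J \<ge> 2\<close> assms(2)] by blast
    have jm: "j \<in> {1..m}"
      using S(1) j by blast
    have "prod q S' > 0"
      using S(2) q_gt_0 by (intro prod_pos) blast
    then have "1 * (1 * K) \<le> prod q S' * (p j * K + 1)"
      using prime_gt_0_nat[OF assms(4)[OF jm]] by (intro mult_le_mono trans_le_add1) auto
    then have "t \<ge> K"
      by (simp add: t_def)
    have "coprime (p j) (prod q S')"
      using \<open>j \<notin> S'\<close> S(2) by (intro prod_coprime_right p_coprime_q[OF jm]) blast+
    moreover have "coprime (p j) (p j * K + 1)"
      by (rule coprimeI) (metis dvd_add_right_iff dvd_mult2)
    ultimately have "coprime (p j) t"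
      unfolding t_def by (simp only: coprime_mult_right_iff)
    then have "coprime (q j) t"
      by (simp add: q_def)
    then have "\<not> q j dvd t"
      using q_gt_1[OF jm] by (metis coprime_absorb_left nat_dvd_1_iff_1 less_irrefl)
    moreover have "q l dvd t" if "l \<in> S'" for l
      using that S(2) unfolding t_def by (intro dvd_mult2 dvd_prodI) (auto intro: finite_subset)
    \<comment> \<open>The count at \<open>(i, t)\<close> is \<open>t\<close> itself:
      \<open>q j\<close> fails to divide it, giving 1 on the left, while every \<open>q l\<close>
      with \<open>l\<close> in \<open>S'\<close> divides it, giving 0 on the right. The restriction
      keeps this point since \<open>t \<ge> K\<close>.\<close>
    ultimately have "B S (i, t) \<noteq> B S' (i, t)"
      using i j \<open>t \<ge> K\<close> by (auto simp: B_def from_time_def)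
    with eq show False
      by simp
  qed
  have inj: "inj_on B (Pow {1..m} - {{}})"
  proof (rule inj_onI)
    fix S S' assume "S \<in> Pow {1..m} - {{}}" "S' \<in> Pow {1..m} - {{}}" "B S = B S'"
    then show "S = S'"
      using mem_if_B_eq[of S S'] mem_if_B_eq[of S' S] by auto
  qed
  have "{from_time K (binary_projection (lca_orbit J r n c)) | c.
      1 \<le> c \<and> c \<le> n - 1 \<and> grows_infinitely (lca_orbit J r n c)} = B ` (Pow {1..m} - {{}})"
    (is "?L = ?R")
  proof
    show "?L \<subseteq> ?R"
      by (auto simp: type_eq grows_iff supp_def)
    show "?R \<subseteq> ?L"
    proof
      fix x assume "x \<in> ?R"
      then obtain S where S: "S \<subseteq> {1..m}" "S \<noteq> {}" "x = B S"
        by auto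
      then obtain c where "1 \<le> c" "c \<le> n - 1" "supp c = S"
        using ex_supp by blast
      with S show "x \<in> ?L"
        unfolding type_eq grows_iff by blast
    qed
  qed
  then show ?thesis
    using inj unfolding K_def by (simp add: card_image card_Diff_singleton card_Pow)
qed

end
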